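(* Let $A$ be a complex $m\times n$ matrix and let $\mathbf{x}\in\mathbb{C}^n$, $\mathbf{y}\in\mathbb{C}^m$ be two unit vectors such that $\sigma_1(A)=\langle A\mathbf{x},\mathbf{y}\rangle$. Then $$\sigma_2(A)\ge\left\|A-\sigma_1(A)\,\mathbf{y}\otimes\overline{\mathbf{x}}\right\|_{\boxdot}.$$ In particular, if $A$ is a (real, entrywise) nonnegative matrix with equal row sums and equal column sums, then $$\sigma_2(A)\ge\left\|A-\rho(A)J_{m,n}\right\|_{\boxdot}.$$
   Context: $\langle\mathbf{u},\mathbf{v}\rangle=\sum_i u_i\overline{v_i}$ is the standard inner product. For $\mathbf{x}=(x_1,\dots,x_n)\in\mathbb{C}^n$ and $\mathbf{y}=(y_1,\dots,y_m)\in\mathbb{C}^m$, $\mathbf{y}\otimes\mathbf{x}$ is the $m\times n$ matrix $[y_ix_j]$; $\overline{\mathbf{x}}$ is the entrywise complex conjugate. $\sigma_1(A)\ge\sigma_2(A)\ge\cdots$ are the singular values of $A$ (with $\sigma_i(A)=0$ for $i>\min(m,n)$). For $X\subset[m]=\{1,\dots,m\}$ and $Y\subset[n]$, $A[X,Y]$ is the submatrix of all $a_{ij}$ with $i\in X$, $j\in Y$; $\Sigma(M)$ is the sum of the entries of a matrix $M$; $\rho(A)=\Sigma(A)/(mn)$; $J_{m,n}$ is the $m\times n$ all-ones matrix. The norm $\|\cdot\|_{\boxdot}$ on $m\times n$ matrices is $$\|A\|_{\boxdot}=\max_{\varnothing\ne X\subset[m],\ \varnothing\ne Y\subset[n]}\frac{1}{\sqrt{|X||Y|}}\left|\Sigma(A[X,Y])\right|.$$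 "Equal row sums" means all row sums equal one another, and likewise for columns. *)

theory Defs
  imports
    "Jordan_Normal_Form.Schur_Decomposition"
    "Jordan_Normal_Form.DL_Submatrix"
    "HOL-Library.Nonpos_Ints"
begin

text \<open>
  Row and column indices are those of \<^typ>\<open>'a mat\<close>, i.e. they start at 0, so the index set [m] is
  \<open>{..<m}\<close>. The inner product \<open>u \<bullet>c v\<close> is linear in \<open>u\<close> and conjugate-linear in \<open>v\<close>.
\<close>

definition tensor_vec :: "complex vec \<Rightarrow> complex vec \<Rightarrow> complex mat" (infixl \<open>\<otimes>\<^sub>v\<close> 70) where
  "y \<otimes>\<^sub>v x = mat (dim_vec y) (dim_vec x) (\<lambda>(i, j). y $ i * x $ j)"

text \<open>
  The square roots of the eigenvalues of \<open>A\<^sup>*A\<close>, counted with algebraic multiplicity, in decreasing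
  order. These eigenvalues are real and nonnegative, so taking real parts loses nothing. The list has
  \<^term>\<open>dim_col A\<close> entries.
\<close>

definition singular_value_list :: "complex mat \<Rightarrow> real list" where
  "singular_value_list A =
     rev (sorted_list_of_multiset
       (image_mset (\<lambda>z. sqrt (Re z)) (proots (char_poly (mat_adjoint A * A)))))"

text \<open>Singular values are numbered from 1.\<close>

definition singular_value :: "nat \<Rightarrow> complex mat \<Rightarrow> real" where
  "singular_value i A =
     (if i \<in> {1..min (dim_row A) (dim_col A)} then singular_value_list A ! (i - 1) else 0)"

definition density_mat :: "complex mat \<Rightarrow> complex" where
  "density_mat A = sum_mat A / of_nat (dim_row A * dim_col A)"

definition all_ones_mat :: "nat \<Rightarrow> nat \<Rightarrow> complex mat" where
  "all_ones_mat m n = mat m n (\<lambda>_. 1)"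

text \<open>Meaningful only for matrices with at least one row and one column.\<close>

definition box_norm :: "complex mat \<Rightarrow> real" where
  "box_norm A =
     Max {1 / sqrt (real (card X) * real (card Y)) * cmod (sum_mat (submatrix A X Y)) | X Y.
            X \<noteq> {} \<and> X \<subseteq> {..<dim_row A} \<and> Y \<noteq> {} \<and> Y \<subseteq> {..<dim_col A}}"

definition nonneg_entries :: "complex mat \<Rightarrow> bool" where
  "nonneg_entries A \<longleftrightarrow> (\<forall>i<dim_row A. \<forall>j<dim_col A. A $$ (i, j) \<in> \<real>\<^sub>\<ge>\<^sub>0)"

definition equal_row_sums :: "complex mat \<Rightarrow> bool" where
  "equal_row_sums A \<longleftrightarrow>
     (\<forall>i<dim_row A. \<forall>i'<dim_row A. (\<Sum>j<dim_col A. A $$ (i, j)) = (\<Sum>j<dim_col A. A $$ (i', j)))"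

definition equal_col_sums :: "complex mat \<Rightarrow> bool" where
  "equal_col_sums A \<longleftrightarrow>
     (\<forall>j<dim_col A. \<forall>j'<dim_col A. (\<Sum>i<dim_row A. A $$ (i, j)) = (\<Sum>i<dim_row A. A $$ (i, j')))"

end

theory Submission
  imports Defs "HOL-Analysis.L2_Norm"
begin

text \<open>
  The box norm is a restriction of the operator norm: for nonempty \<open>X\<close> and \<open>Y\<close> the quotient
  \<open>\<Sigma>(B[X,Y]) / sqrt (|X| |Y|)\<close> is \<open>\<langle>Bu, w\<rangle>\<close> for the normalized indicator vectors \<open>u\<close> of \<open>Y\<close> and
  \<open>w\<close> of \<open>X\<close>, so by Cauchy-Schwarz it is at most the operator norm of \<open>B\<close> (\<open>box_norm_le\<close>). It remains
  to see that \<open>B = A - \<sigma>\<^sub>1 y \<otimes> x\<^sup>*\<close> has operator norm at most \<open>\<sigma>\<^sub>2\<close>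
  (\<open>cnorm_deflation_le_singular_value_2\<close>).

  Since \<open>\<sigma>\<^sub>1\<close> is the operator norm of \<open>A\<close>, the chain \<open>\<sigma>\<^sub>1 = \<langle>Ax, y\<rangle> \<le> |Ax| \<le> \<sigma>\<^sub>1\<close> forces \<open>Ax = \<sigma>\<^sub>1 y\<close>. Hence
  \<open>Bv = Au\<close>, where \<open>u = v - \<langle>v, x\<rangle> x\<close> is the part of \<open>v\<close> orthogonal to \<open>x\<close>, and \<open>|u| \<le> |v|\<close>. So the claim
  becomes the estimate \<open>|Au| \<le> \<sigma>\<^sub>2 |u|\<close> for \<open>u\<close> orthogonal to an arbitrary maximizing vector \<open>x\<close>
  (\<open>cnorm_mult_le_singular_value_2\<close>). In coordinates \<open>c\<close> with respect to an orthonormal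
  eigenbasis of \<open>A\<^sup>*A\<close> one has \<open>|Av|\<^sup>2 = \<Sum>\<^sub>i \<sigma>\<^sub>i\<^sup>2 |c\<^sub>i|\<^sup>2\<close> (\<open>right_singular_basis\<close>). If \<open>\<sigma>\<^sub>2 = \<sigma>\<^sub>1\<close> there is
  nothing to prove; otherwise the maximizer \<open>x\<close> must be a multiple of the first basis vector, so the
  first coordinate of \<open>u\<close> vanishes. If \<open>m = 1\<close> or \<open>n = 1\<close>, then \<open>\<sigma>\<^sub>2 = 0\<close> by convention and one
  checks \<open>Au = 0\<close> directly.

  For the second claim the constant unit vectors \<open>x\<close> and \<open>y\<close> satisfy \<open>\<langle>Ax, y\<rangle> = \<Sigma>(A) / sqrt (m n)\<close>, and
  the Schur test shows that this is the largest singular value. With these vectors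
  \<open>\<sigma>\<^sub>1 y \<otimes> x\<^sup>*\<close> is \<open>\<rho>(A) J\<close>, so the first claim applies.
\<close>

section \<open>The Euclidean norm and the adjoint\<close>

definition cnorm :: "complex vec \<Rightarrow> real" where
  "cnorm v = L2_set (\<lambda>i. cmod (v $ i)) {..<dim_vec v}"

lemma cnorm_nonneg [simp]: "0 \<le> cnorm v"
  by (simp add: cnorm_def)

lemma cnorm_power2: "(cnorm v)\<^sup>2 = (\<Sum>i<dim_vec v. (cmod (v $ i))\<^sup>2)"
  by (simp add: cnorm_def L2_set_def sum_nonneg)

lemma cscalar_prod_sum:
  fixes u v :: "complex vec"
  assumes "dim_vec u = dim_vec v"
  shows "u \<bullet>c v = (\<Sum>i<dim_vec v. u $ i * cnj (v $ i))"
  using assms by (simp add: scalar_prod_def atLeast0LessThan)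

lemma cscalar_prod_self: "v \<bullet>c v = complex_of_real ((cnorm v)\<^sup>2)"
  by (simp add: cscalar_prod_sum cnorm_power2 complex_mult_cnj cmod_power2)

lemma cnorm_eq_1_iff: "cnorm v = 1 \<longleftrightarrow> v \<bullet>c v = 1"
  unfolding cscalar_prod_self
  by (metis cnorm_nonneg of_real_1 of_real_eq_iff one_power2 pos2 power2_eq_iff_nonneg zero_le_one)

lemma cnorm_eq_0D: "cnorm v = 0 \<Longrightarrow> i < dim_vec v \<Longrightarrow> v $ i = 0"
  by (simp add: cnorm_def L2_set_eq_0_iff)

lemma cscalar_prod_le_cnorm:
  fixes u v :: "complex vec"
  assumes "dim_vec u = dim_vec v"
  shows "cmod (u \<bullet>c v) \<le> cnorm u * cnorm v"
proof -
  have "cmod (u \<bullet>c v) \<le> (\<Sum>i<dim_vec v. \<bar>cmod (u $ i)\<bar> * \<bar>cmod (v $ i)\<bar>)"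
    unfolding cscalar_prod_sum[OF assms] by (rule order_trans[OF norm_sum]) (simp add: norm_mult)
  also have "\<dots> \<le> cnorm u * cnorm v"
    unfolding cnorm_def assms by (rule L2_set_mult_ineq)
  finally show ?thesis .
qed

lemma cnorm_diff_smult_power2:
  fixes u v :: "complex vec"
  assumes "dim_vec u = dim_vec v"
  shows "(cnorm (u - k \<cdot>\<^sub>v v))\<^sup>2 = (cnorm u)\<^sup>2 - 2 * Re (cnj k * (u \<bullet>c v)) + (cmod k)\<^sup>2 * (cnorm v)\<^sup>2"
proof -
  have "(cmod (a - k * b))\<^sup>2 = (cmod a)\<^sup>2 - 2 * Re (cnj k * (a * cnj b)) + (cmod k)\<^sup>2 * (cmod b)\<^sup>2" for a b
    unfolding cmod_power2 by (simp add: power2_eq_square algebra_simps)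
  then show ?thesis using assms
    by (simp add: cnorm_power2 cscalar_prod_sum sum_distrib_left sum.distrib sum_subtractf)
qed

lemma dim_mat_adjoint [simp]:
  "dim_row (mat_adjoint A) = dim_col A" "dim_col (mat_adjoint A) = dim_row A"
  by (simp_all add: mat_adjoint_def)

lemma index_mat_adjoint [simp]:
  assumes "i < dim_col A" "j < dim_row A"
  shows "mat_adjoint A $$ (i, j) = conjugate (A $$ (j, i))"
  using assms by (simp add: mat_adjoint_def mat_of_rows_def)

lemma mat_adjoint_carrier [simp]: "A \<in> carrier_mat m n \<Longrightarrow> mat_adjoint A \<in> carrier_mat n m"
  by (intro carrier_matI) (simp_all add: carrier_matD)

lemma mat_adjoint_mult:
  fixes A :: "complex mat"
  assumes "A \<in> carrier_mat k m" "B \<in> carrier_mat m n"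
  shows "mat_adjoint (A * B) = mat_adjoint B * mat_adjoint A"
proof (rule eq_matI)
  fix i j assume "i < dim_row (mat_adjoint B * mat_adjoint A)" "j < dim_col (mat_adjoint B * mat_adjoint A)"
  then have ij: "i < n" "j < k" using assms by auto
  have "mat_adjoint (A * B) $$ (i, j) = (\<Sum>l<m. cnj (A $$ (j, l)) * cnj (B $$ (l, i)))"
    using assms ij by (simp add: scalar_prod_def atLeast0LessThan)
  also have "\<dots> = (mat_adjoint B * mat_adjoint A) $$ (i, j)"
    using assms ij by (simp add: scalar_prod_def atLeast0LessThan mult.commute)
  finally show "mat_adjoint (A * B) $$ (i, j) = (mat_adjoint B * mat_adjoint A) $$ (i, j)" .
qed (use assms in auto)

lemma mat_adjoint_adjoint [simp]: "mat_adjoint (mat_adjoint A) = A"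
  by (rule eq_matI) auto

lemma cscalar_prod_mat_adjoint:
  fixes A :: "complex mat"
  assumes A: "A \<in> carrier_mat m n" and v: "v \<in> carrier_vec n" and w: "w \<in> carrier_vec m"
  shows "(A *\<^sub>v v) \<bullet>c w = v \<bullet>c (mat_adjoint A *\<^sub>v w)"
proof -
  have "(A *\<^sub>v v) \<bullet>c w = (\<Sum>i<m. \<Sum>j<n. A $$ (i, j) * v $ j * cnj (w $ i))"
    using assms by (simp add: scalar_prod_def atLeast0LessThan sum_distrib_right)
  also have "\<dots> = (\<Sum>j<n. \<Sum>i<m. A $$ (i, j) * v $ j * cnj (w $ i))"
    by (rule sum.swap)
  also have "\<dots> = v \<bullet>c (mat_adjoint A *\<^sub>v w)"
    using assms by (auto simp: scalar_prod_def atLeast0LessThan sum_distrib_left intro!: sum.cong)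
  finally show ?thesis .
qed

lemma cnorm_mult_mat_vec_power2:
  assumes A: "A \<in> carrier_mat m n" and v: "v \<in> carrier_vec n"
  shows "complex_of_real ((cnorm (A *\<^sub>v v))\<^sup>2) = v \<bullet>c ((mat_adjoint A * A) *\<^sub>v v)"
proof -
  have "A *\<^sub>v v \<in> carrier_vec m" using assms by simp
  from cscalar_prod_mat_adjoint[OF A v this] show ?thesis
    unfolding assoc_mult_mat_vec[OF mat_adjoint_carrier[OF A] A v] cscalar_prod_self .
qed

lemma cnorm_unitary:
  assumes U: "U \<in> carrier_mat n n" and UU: "mat_adjoint U * U = 1\<^sub>m n" and v: "v \<in> carrier_vec n"
  shows "cnorm (U *\<^sub>v v) = cnorm v"
proof -
  have "complex_of_real ((cnorm (U *\<^sub>v v))\<^sup>2) = complex_of_real ((cnorm v)\<^sup>2)"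
    unfolding cnorm_mult_mat_vec_power2[OF U v] UU one_mult_mat_vec[OF v] by (rule cscalar_prod_self)
  then have "(cnorm (U *\<^sub>v v))\<^sup>2 = (cnorm v)\<^sup>2"
    by (rule of_real_eq_iff[THEN iffD1])
  then show ?thesis
    by (rule power2_eq_imp_eq) simp_all
qed

section \<open>Unitary diagonalization of Hermitian matrices\<close>

text \<open>Gram-Schmidt keeps the first vector, so it suffices to normalize its output.\<close>

lemma exists_orthonormal_basis_extending:
  fixes v :: "complex vec"
  assumes v: "v \<in> carrier_vec n" and v1: "v \<bullet>c v = 1"
  shows "\<exists>W \<in> carrier_mat n n. mat_adjoint W * W = 1\<^sub>m n \<and> col W 0 = v"
proof -
  have v0: "v \<noteq> 0\<^sub>v n"
    using v1 conjugate_square_eq_0_vec[OF v] by simp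
  have n: "n > 0"
  proof (rule ccontr)
    assume "\<not> n > 0"
    then have "v = 0\<^sub>v n" using carrier_vecD[OF v] by (intro eq_vecI) simp_all
    with v0 show False by contradiction
  qed
  interpret cof_vec_space n "TYPE(complex)" .
  define ws where "ws = gram_schmidt n (basis_completion v)"
  note bc = basis_completion[OF v v0]
  have ws: "set ws \<subseteq> carrier_vec n" "corthogonal ws" "length ws = n"
    using gram_schmidt_result[OF bc(2) bc(4) bc(5) refl] bc(6) by (auto simp: ws_def)
  have wsc: "ws ! i \<in> carrier_vec n" if "i < n" for i using ws that by auto
  have ws0: "ws ! 0 = v"
  proof -
    obtain vs where "basis_completion v = v # vs"
      using bc(6,7) n by (cases "basis_completion v") auto
    then have "hd ws = v" unfolding ws_def using gram_schmidt_hd[OF v] by simp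
    then show ?thesis using ws(3) n by (cases ws) auto
  qed
  define us where "us = (\<lambda>i. complex_of_real (1 / cnorm (ws ! i)) \<cdot>\<^sub>v ws ! i)"
  define W where "W = mat_of_cols n (map us [0..<n])"
  have usc: "us i \<in> carrier_vec n" if "i < n" for i using wsc[OF that] by (simp add: us_def)
  have W: "W \<in> carrier_mat n n"
    unfolding W_def using mat_of_cols_carrier(1)[of n "map us [0..<n]"] by simp
  have colW: "col W i = us i" if "i < n" for i
    using that usc by (simp add: W_def)
  have ortho: "us i \<bullet>c us j = (if i = j then 1 else 0)" if ij: "i < n" "j < n" for i j
  proof -
    have "us i \<bullet>c us j = complex_of_real (1 / cnorm (ws ! i)) * complex_of_real (1 / cnorm (ws ! j)) * (ws ! i \<bullet>c ws ! j)"
      using wsc[OF ij(1)] wsc[OF ij(2)]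
      by (simp add: us_def cscalar_prod_sum sum_distrib_left algebra_simps)
    moreover have "ws ! i \<bullet>c ws ! j = 0 \<longleftrightarrow> i \<noteq> j"
      using corthogonalD[OF ws(2)] ij ws(3) by simp
    moreover have "cnorm (ws ! i) \<noteq> 0" 
      using corthogonalD[OF ws(2), of i i] ij ws(3) by (simp add: cscalar_prod_self)
    ultimately show ?thesis
      by (auto simp: cscalar_prod_self power2_eq_square)
  qed
  have "mat_adjoint W * W = 1\<^sub>m n"
  proof (rule eq_matI)
    fix i j assume "i < dim_row (1\<^sub>m n :: complex mat)" "j < dim_col (1\<^sub>m n :: complex mat)"
    then have ij: "i < n" "j < n" by auto
    have "row (mat_adjoint W) i = conjugate (us i)"
      using W ij usc[OF ij(1)] colW[OF ij(1), symmetric] by (intro eq_vecI) auto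
    then have "(mat_adjoint W * W) $$ (i, j) = conjugate (us i) \<bullet> us j"
      using W ij colW by simp
    also have "\<dots> = us j \<bullet>c us i"
      using usc ij by (intro comm_scalar_prod) auto
    finally show "(mat_adjoint W * W) $$ (i, j) = 1\<^sub>m n $$ (i, j)"
      using ij ortho by auto
  qed (use W in auto)
  moreover have "col W 0 = v"
    using colW[OF n] ws0 v1 v by (auto simp: us_def cnorm_eq_1_iff[THEN iffD2])
  ultimately show ?thesis using W by blast
qed

text \<open>
  Conjugating \<open>A\<close> by a unitary \<open>W\<close> whose first column is an eigenvector for \<open>e\<close> clears the first
  column below the diagonal. The result is again Hermitian, so the first row is cleared as well and the
  remaining block is a smaller Hermitian matrix, whose characteristic polynomial has lost the factor
  of \<open>e\<close>. The list \<open>es\<close> prescribes the order of the diagonal; later it is chosen decreasing, so that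
  positions on the diagonal match the numbering of singular values.
\<close>

theorem hermitian_unitary_diagonalization:
  fixes A :: "complex mat"
  assumes "A \<in> carrier_mat n n" and "mat_adjoint A = A"
    and "char_poly A = (\<Prod>e\<leftarrow>es. [:- e, 1:])"
  shows "\<exists>U D. U \<in> carrier_mat n n \<and> D \<in> carrier_mat n n \<and> mat_adjoint U * U = 1\<^sub>m n \<and>
           mat_adjoint U * A * U = D \<and> diagonal_mat D \<and> diag_mat D = es"
  using assms
proof (induction es arbitrary: n A)
  case Nil
  then have "n = 0" using degree_monic_char_poly[of A n] by simp
  with Nil have "mat_adjoint (1\<^sub>m 0) * (1\<^sub>m 0 :: complex mat) = 1\<^sub>m 0" by (intro eq_matI) auto
  then show ?case using \<open>n = 0\<close> Nil
    by (intro exI[of _ "1\<^sub>m 0"] exI[of _ "A"]) (auto simp: diagonal_mat_def diag_mat_def intro!: eq_matI)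
next
  case (Cons e es)
  note A = Cons.prems(1)
  have cp: "char_poly A = [:- e, 1:] * (\<Prod>e\<leftarrow>es. [:- e, 1:])" using Cons.prems(3) by simp
  have "monic (\<Prod>e\<leftarrow>es. [:- e, 1:])" by (rule monic_prod_list) auto
  then have "degree (char_poly A) = Suc (degree (\<Prod>e\<leftarrow>es. [:- e, 1:]))"
    unfolding cp by (subst degree_mult_eq) auto
  then obtain k where n: "n = Suc k" using degree_monic_char_poly[OF A] by auto
  have "eigenvalue A e" unfolding eigenvalue_root_char_poly[OF A] cp by simp
  then obtain w where w: "w \<in> carrier_vec n" "w \<noteq> 0\<^sub>v n" "A *\<^sub>v w = e \<cdot>\<^sub>v w"
    using A unfolding eigenvalue_def eigenvector_def by auto
  have cw: "cnorm w \<noteq> 0" using cnorm_eq_0D[of w] w by (auto intro!: eq_vecI)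
  define v where "v = complex_of_real (1 / cnorm w) \<cdot>\<^sub>v w"
  have v: "v \<in> carrier_vec n" using w by (simp add: v_def)
  have "v \<bullet>c v = 1"
    using w(1) cw by (simp add: v_def conjugate_smult_vec cscalar_prod_self power2_eq_square)
  then obtain W where W: "W \<in> carrier_mat n n" "mat_adjoint W * W = 1\<^sub>m n" "col W 0 = v"
    using exists_orthonormal_basis_extending[OF v] by blast
  have Av: "A *\<^sub>v v = e \<cdot>\<^sub>v v"
    using w A by (simp add: v_def mult_mat_vec smult_smult_assoc mult.commute)
  let ?W = "mat_adjoint W"
  have W': "?W \<in> carrier_mat n n" using W by simp
  have WW: "W * ?W = 1\<^sub>m n" using mat_mult_left_right_inverse[OF W' W(1) W(2)] .
  define B where "B = ?W * A * W"
  have B: "B \<in> carrier_mat n n" using A W unfolding B_def by auto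
  have Badj: "mat_adjoint B = B"
    unfolding B_def using A W(1) W' Cons.prems(2)
    by (simp add: mat_adjoint_mult[of _ n n _ n] mult_carrier_mat[of _ n n _ n] assoc_mult_mat[of _ n n _ n _ n])
  have Bcol: "B $$ (i, 0) = (if i = 0 then e else 0)" if i: "i < n" for i
  proof -
    have "B $$ (i, 0) = col B 0 $ i" using B n i by simp
    also have "col B 0 = ?W *\<^sub>v (A *\<^sub>v v)"
    proof -
      have "col B 0 = (?W * A) *\<^sub>v col W 0"
        unfolding B_def using n by (intro col_mult2[of _ n n]) (use A W(1) W' in auto)
      then show ?thesis
        unfolding W(3) using assoc_mult_mat_vec[OF W' A v] by simp
    qed
    also have "\<dots> = e \<cdot>\<^sub>v (?W *\<^sub>v col W 0)"
      unfolding Av W(3) using v W' by (simp add: mult_mat_vec)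
    also have "?W *\<^sub>v col W 0 = col (?W * W) 0"
      using n by (intro col_mult2[OF W' W(1), symmetric]) auto
    finally show ?thesis using i n by (simp add: W(2))
  qed
  have Brow: "B $$ (0, j) = (if j = 0 then cnj e else 0)" if "j < n" for j
    using arg_cong[OF Badj, of "\<lambda>M. M $$ (0, j)"] Bcol[OF that] B that n by auto
  obtain B1 B2 B0 C where spl: "split_block B 1 1 = (B1, B2, B0, C)"
    by (cases "split_block B 1 1") auto
  have dims: "dim_row B = 1 + k" "dim_col B = 1 + k" using B n by auto
  note sb = split_block[OF spl dims]
  have C: "C = mat k k (\<lambda>(i, j). B $$ (Suc i, Suc j))"
    and B1: "B1 = mat 1 1 (\<lambda>_. e)" and B2: "B2 = 0\<^sub>m 1 k" and B0: "B0 = 0\<^sub>m k 1"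
    using spl Bcol Brow dims n by (auto simp: split_block_def Let_def intro!: eq_matI)
  have Cc: "C \<in> carrier_mat k k" by (simp add: C)
  have Cadj: "mat_adjoint C = C"
  proof (rule eq_matI)
    fix i j assume "i < dim_row C" "j < dim_col C"
    then have ij: "i < k" "j < k" using Cc by auto
    then show "mat_adjoint C $$ (i, j) = C $$ (i, j)"
      using arg_cong[OF Badj, of "\<lambda>M. M $$ (Suc i, Suc j)"] dims by (simp add: C)
  qed (use Cc in auto)
  have "similar_mat_wit B A ?W W"
    by (rule similar_mat_witI[of _ _ n]) (use W W' WW A B in \<open>auto simp: B_def\<close>)
  then have "char_poly A = char_poly B"
    using char_poly_similar unfolding similar_mat_def by metis
  also have "\<dots> = char_poly B1 * char_poly C"
    unfolding sb(5) B0 by (rule char_poly_four_block_zeros_col) (use sb in auto)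
  also have "char_poly B1 = [:- e, 1:]"
    by (simp add: B1 char_poly_defs det_def sign_def)
  finally have "char_poly C = (\<Prod>e\<leftarrow>es. [:- e, 1:])"
    unfolding cp by (metis mult_cancel_left pCons_eq_0_iff zero_neq_one)
  from Cons.IH[OF Cc Cadj this] obtain V D where
    V: "V \<in> carrier_mat k k" "mat_adjoint V * V = 1\<^sub>m k"
    and D: "D \<in> carrier_mat k k" "mat_adjoint V * C * V = D" "diagonal_mat D" "diag_mat D = es"
    by blast
  define V' where "V' = four_block_mat (1\<^sub>m 1) (0\<^sub>m 1 k) (0\<^sub>m k 1) V"
  define D' where "D' = four_block_mat (mat 1 1 (\<lambda>_. e)) (0\<^sub>m 1 k) (0\<^sub>m k 1) D"
  have V': "V' \<in> carrier_mat n n" and D': "D' \<in> carrier_mat n n"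
    using four_block_carrier_mat[OF one_carrier_mat[of 1] V(1), of "0\<^sub>m 1 k" "0\<^sub>m k 1"]
      four_block_carrier_mat[OF mat_carrier[of 1 1 "\<lambda>_. e"] D(1), of "0\<^sub>m 1 k" "0\<^sub>m k 1"]
    unfolding V'_def D'_def n by simp_all
  have V'adj: "mat_adjoint V' = four_block_mat (1\<^sub>m 1) (0\<^sub>m 1 k) (0\<^sub>m k 1) (mat_adjoint V)"
    using V by (intro eq_matI) (auto simp: V'_def)
  have V'V': "mat_adjoint V' * V' = 1\<^sub>m n"
    unfolding V'adj unfolding V'_def using V(1)
    by (subst mult_four_block_mat[of _ 1 1 _ k _ k]) (auto simp: V(2) n)
  have B_block: "B = four_block_mat (mat 1 1 (\<lambda>_. e)) (0\<^sub>m 1 k) (0\<^sub>m k 1) C"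
    using sb(5) unfolding B1 B2 B0 .
  have "mat_adjoint V' * B = four_block_mat (mat 1 1 (\<lambda>_. e)) (0\<^sub>m 1 k) (0\<^sub>m k 1) (mat_adjoint V * C)"
    unfolding V'adj B_block using V(1) Cc
    by (subst mult_four_block_mat[of _ 1 1 _ k _ k]) auto
  then have VBV: "mat_adjoint V' * B * V' = D'"
    unfolding V'_def D'_def using V(1) Cc
    by (simp only:, subst mult_four_block_mat[of _ 1 1 _ k _ k]) (auto simp: D(2) left_add_zero_mat[OF D(1)])
  have diag: "mat_adjoint (W * V') * A * (W * V') = D'"
    unfolding VBV[symmetric]
    using W(1) W' V' A unfolding B_def
    by (simp add: mat_adjoint_mult[of _ n n _ n] assoc_mult_mat[of _ n n _ n _ n] mult_carrier_mat[of _ n n _ n])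
  have "mat_adjoint (W * V') * (W * V') = mat_adjoint V' * (?W * W) * V'"
    using W(1) W' V' 
    by (simp add: mat_adjoint_mult[of _ n n _ n] assoc_mult_mat[of _ n n _ n _ n] mult_carrier_mat[of _ n n _ n])
  then have unitary: "mat_adjoint (W * V') * (W * V') = 1\<^sub>m n"
    using V' V'V' by (simp add: W(2))
  have diagonal: "diagonal_mat D'"
    using D by (auto simp: D'_def diagonal_mat_def)
  have entries: "diag_mat D' = e # es"
    unfolding D'_def using D by (subst diag_four_block_mat[of _ 1 _ k]) (auto simp: diag_mat_def)
  show ?case
    using mult_carrier_mat[OF W(1) V'] D' unitary diag diagonal entries by blast
qed


section \<open>Singular values as extrema\<close>

lemma proots_prod_linear_factors:
  fixes es :: "'a :: field list"
  shows "proots (\<Prod>e\<leftarrow>es. [:- e, 1:]) = mset es"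
proof (induction es)
  case (Cons e es)
  have "(\<Prod>e\<leftarrow>es. [:- e, 1:]) \<noteq> 0"
    by (auto simp: prod_list_zero_iff)
  then have "proots ([:- e, 1:] * (\<Prod>e\<leftarrow>es. [:- e, 1:])) = proots [:- e, 1:] + proots (\<Prod>e\<leftarrow>es. [:- e, 1:])"
    by (intro proots_mult) auto
  then show ?case using Cons.IH by simp
qed simp

text \<open>
  The square root is monotone, so ordering the eigenvalues by decreasing real part already orders their
  square roots.
\<close>

lemma singular_value_list_eq_map:
  assumes cp: "char_poly (mat_adjoint A * A) = (\<Prod>e\<leftarrow>es. [:- e, 1:])"
    and sorted: "sorted (map Re (rev es))"
  shows "singular_value_list A = map (\<lambda>z. sqrt (Re z)) es"
proof -
  have "sorted (map (\<lambda>z. sqrt (Re z)) (rev es))"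
    using sorted by (simp add: sorted_map sorted_wrt_rev)
  then have "sort (map (\<lambda>z. sqrt (Re z)) es) = map (\<lambda>z. sqrt (Re z)) (rev es)"
    by (intro properties_for_sort) simp_all
  moreover have "image_mset (\<lambda>z. sqrt (Re z)) (proots (char_poly (mat_adjoint A * A)))
      = mset (map (\<lambda>z. sqrt (Re z)) es)"
    unfolding cp proots_prod_linear_factors by simp
  ultimately show ?thesis
    by (simp only: singular_value_list_def sorted_list_of_multiset_mset) (simp add: rev_map)
qed

text \<open>
  Let \<open>U\<close> diagonalize \<open>A\<^sup>*A\<close>, with eigenvalues \<open>e\<^sub>i\<close> in decreasing order. Then
  \<open>|AUc|\<^sup>2 = \<langle>c, U\<^sup>*A\<^sup>*AUc\<rangle> = \<Sum>\<^sub>i cnj e\<^sub>i |c\<^sub>i|\<^sup>2\<close>. Evaluating this at the unit vectors shows that each \<open>e\<^sub>i\<close> is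
  real and nonnegative, hence the square of the singular value at the same position. The extremal
  properties of singular values below are read off from this weighted sum of squares.
\<close>

theorem right_singular_basis:
  assumes A: "A \<in> carrier_mat m n"
  shows "\<exists>U \<in> carrier_mat n n. mat_adjoint U * U = 1\<^sub>m n \<and>
    (\<forall>c \<in> carrier_vec n. (cnorm (A *\<^sub>v (U *\<^sub>v c)))\<^sup>2 = (\<Sum>i<n. (singular_value_list A ! i * cmod (c $ i))\<^sup>2))"
    and "\<And>i. i < n \<Longrightarrow> 0 \<le> singular_value_list A ! i"
    and "\<And>i j. i \<le> j \<Longrightarrow> j < n \<Longrightarrow> singular_value_list A ! j \<le> singular_value_list A ! i"
proof -
  note A' = mat_adjoint_carrier[OF A]
  define H where "H = mat_adjoint A * A"
  have H: "H \<in> carrier_mat n n" unfolding H_def by (rule mult_carrier_mat[OF A' A])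
  have Hadj: "mat_adjoint H = H" unfolding H_def mat_adjoint_mult[OF A' A] by simp
  obtain es0 where es0: "char_poly H = (\<Prod>e\<leftarrow>es0. [:- e, 1:])" "length es0 = n"
    using char_poly_factorized[OF H] by blast
  define es where "es = rev (sort_key Re es0)"
  have "(\<Prod>e\<leftarrow>es0. [:- e, 1:]) = (\<Prod>e\<leftarrow>es. [:- e, 1:])"
    unfolding prod_mset_prod_list[symmetric] es_def by simp
  with es0 have cp: "char_poly H = (\<Prod>e\<leftarrow>es. [:- e, 1:])" by simp
  have len: "length es = n" using es0 by (simp add: es_def)
  have sorted: "sorted (map Re (rev es))" unfolding es_def by simp
  have svl: "singular_value_list A ! i = sqrt (Re (es ! i))" if "i < n" for i
    using singular_value_list_eq_map[OF cp[unfolded H_def] sorted] that len by simp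
  obtain U D where U: "U \<in> carrier_mat n n" "mat_adjoint U * U = 1\<^sub>m n"
    and D: "D \<in> carrier_mat n n" "mat_adjoint U * H * U = D" "diagonal_mat D" "diag_mat D = es"
    using hermitian_unitary_diagonalization[OF H Hadj cp] by blast
  note U' = mat_adjoint_carrier[OF U(1)]
  have AU: "A * U \<in> carrier_mat m n" by (rule mult_carrier_mat[OF A U(1)])
  have "mat_adjoint (A * U) * (A * U) = D"
    unfolding mat_adjoint_mult[OF A U(1)] D(2)[symmetric] H_def
    by (simp only: assoc_mult_mat[OF U' A' AU] assoc_mult_mat[OF A' A U(1)] assoc_mult_mat[OF U' mult_carrier_mat[OF A' A] U(1)])
  note norm_AU = cnorm_mult_mat_vec_power2[OF AU, unfolded this]
  have Dij: "D $$ (i, j) = (if i = j then es ! i else 0)" if "i < n" "j < n" for i j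
    using D that by (auto simp: diag_mat_def diagonal_mat_def)
  have Dc: "(D *\<^sub>v c) $ i = es ! i * c $ i" if "c \<in> carrier_vec n" "i < n" for c i
  proof -
    have "(D *\<^sub>v c) $ i = (\<Sum>j<n. (if i = j then es ! i else 0) * c $ j)"
      using D(1) that Dij by (simp add: scalar_prod_def atLeast0LessThan)
    also have "\<dots> = es ! i * c $ i" using that by (simp add: if_distrib[of "\<lambda>z. z * _"] cong: if_cong)
    finally show ?thesis .
  qed
  have form: "complex_of_real ((cnorm (A *\<^sub>v (U *\<^sub>v c)))\<^sup>2) = (\<Sum>i<n. cnj (es ! i) * (complex_of_real (cmod (c $ i)))\<^sup>2)"
    if c: "c \<in> carrier_vec n" for c
  proof -
    have "c \<bullet>c (D *\<^sub>v c) = (\<Sum>i<n. c $ i * cnj (es ! i * c $ i))"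
      using c D(1) by (subst cscalar_prod_sum) (auto simp: Dc simp del: complex_cnj_mult index_mult_mat_vec)
    also have "\<dots> = (\<Sum>i<n. cnj (es ! i) * (complex_of_real (cmod (c $ i)))\<^sup>2)"
      by (intro sum.cong refl) (simp add: complex_norm_square[symmetric] mult.left_commute)
    finally show ?thesis
      using norm_AU[OF c] unfolding assoc_mult_mat_vec[OF A U(1) c] by simp
  qed
  have es_nonneg: "es ! i = complex_of_real ((singular_value_list A ! i)\<^sup>2)" "0 \<le> singular_value_list A ! i"
    if i: "i < n" for i
  proof -
    define r where "r = (cnorm (A *\<^sub>v (U *\<^sub>v unit_vec n i)))\<^sup>2"
    have "(\<Sum>j<n. cnj (es ! j) * (complex_of_real (cmod (unit_vec n i $ j)))\<^sup>2) = (\<Sum>j<n. if j = i then cnj (es ! j) else 0)"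
      using i by (intro sum.cong refl) auto
    then have "complex_of_real r = cnj (es ! i)"
      unfolding r_def form[OF unit_vec_carrier] using i by simp
    then have "es ! i = complex_of_real r"
      by (metis complex_cnj_cnj complex_cnj_complex_of_real)
    moreover have "0 \<le> r" by (simp add: r_def)
    ultimately show "es ! i = complex_of_real ((singular_value_list A ! i)\<^sup>2)" "0 \<le> singular_value_list A ! i"
      using svl[OF i] by simp_all
  qed
  show "\<exists>U \<in> carrier_mat n n. mat_adjoint U * U = 1\<^sub>m n \<and>
    (\<forall>c \<in> carrier_vec n. (cnorm (A *\<^sub>v (U *\<^sub>v c)))\<^sup>2 = (\<Sum>i<n. (singular_value_list A ! i * cmod (c $ i))\<^sup>2))"
  proof (intro bexI[OF _ U(1)] conjI U(2) ballI)
    fix c :: "complex vec" assume c: "c \<in> carrier_vec n"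
    have "complex_of_real ((cnorm (A *\<^sub>v (U *\<^sub>v c)))\<^sup>2)
        = complex_of_real (\<Sum>i<n. (singular_value_list A ! i * cmod (c $ i))\<^sup>2)"
      unfolding form[OF c] of_real_sum
      by (intro sum.cong refl) (simp add: es_nonneg(1) power_mult_distrib)
    then show "(cnorm (A *\<^sub>v (U *\<^sub>v c)))\<^sup>2 = (\<Sum>i<n. (singular_value_list A ! i * cmod (c $ i))\<^sup>2)"
      by (rule of_real_eq_iff[THEN iffD1])
  qed
  show "0 \<le> singular_value_list A ! i" if "i < n" for i
    using es_nonneg(2) that by blast
  show "singular_value_list A ! j \<le> singular_value_list A ! i" if "i \<le> j" "j < n" for i j
  proof -
    have "sorted_wrt (\<lambda>x y. Re y \<le> Re x) es"
      using sorted by (simp add: sorted_map sorted_wrt_rev)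
    then have "Re (es ! j) \<le> Re (es ! i)"
      using that len by (cases "i = j") (auto simp: sorted_wrt_iff_nth_less)
    then show ?thesis using svl that by simp
  qed
qed

lemma unitary_coordinates:
  assumes U: "U \<in> carrier_mat n n" and UU: "mat_adjoint U * U = 1\<^sub>m n" and v: "v \<in> carrier_vec n"
  obtains c where "c \<in> carrier_vec n" "v = U *\<^sub>v c" "cnorm c = cnorm v"
proof
  note U' = mat_adjoint_carrier[OF U]
  show c: "mat_adjoint U *\<^sub>v v \<in> carrier_vec n" by (rule mult_mat_vec_carrier[OF U' v])
  show v_eq: "v = U *\<^sub>v (mat_adjoint U *\<^sub>v v)"
    using mat_mult_left_right_inverse[OF U' U UU] v assoc_mult_mat_vec[OF U U' v] by simp
  show "cnorm (mat_adjoint U *\<^sub>v v) = cnorm v"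
    using cnorm_unitary[OF U UU c] v_eq by simp
qed

lemma cscalar_prod_unitary:
  fixes U :: "complex mat"
  assumes U: "U \<in> carrier_mat n n" and UU: "mat_adjoint U * U = 1\<^sub>m n"
    and c: "c \<in> carrier_vec n" and d: "d \<in> carrier_vec n"
  shows "(U *\<^sub>v c) \<bullet>c (U *\<^sub>v d) = c \<bullet>c d"
proof -
  have "(U *\<^sub>v c) \<bullet>c (U *\<^sub>v d) = c \<bullet>c (mat_adjoint U *\<^sub>v (U *\<^sub>v d))"
    using U d by (intro cscalar_prod_mat_adjoint[OF U c]) simp
  then show ?thesis
    using assoc_mult_mat_vec[OF mat_adjoint_carrier[OF U] U d] UU d by simp
qed

lemma cnorm_mult_le_singular_value_1:
  assumes A: "A \<in> carrier_mat m n" and mn: "1 \<le> m" "1 \<le> n" and v: "v \<in> carrier_vec n"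
  shows "cnorm (A *\<^sub>v v) \<le> singular_value 1 A * cnorm v"
proof -
  have s: "singular_value 1 A = singular_value_list A ! 0"
    using A mn by (simp add: singular_value_def)
  obtain U where U: "U \<in> carrier_mat n n" "mat_adjoint U * U = 1\<^sub>m n"
    and form: "\<And>c. c \<in> carrier_vec n \<Longrightarrow>
      (cnorm (A *\<^sub>v (U *\<^sub>v c)))\<^sup>2 = (\<Sum>i<n. (singular_value_list A ! i * cmod (c $ i))\<^sup>2)"
    using right_singular_basis(1)[OF A] by blast
  obtain c where c: "c \<in> carrier_vec n" "v = U *\<^sub>v c" "cnorm c = cnorm v"
    using unitary_coordinates[OF U v] .
  have "(cnorm (A *\<^sub>v v))\<^sup>2 \<le> (\<Sum>i<n. (singular_value_list A ! 0 * cmod (c $ i))\<^sup>2)"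
    unfolding c(2) form[OF c(1)]
    by (intro sum_mono power_mono mult_right_mono mult_nonneg_nonneg)
      (use right_singular_basis(2,3)[OF A] in auto)
  also have "\<dots> = (singular_value 1 A * cnorm v)\<^sup>2"
    unfolding s c(3)[symmetric] power_mult_distrib cnorm_power2
    using c(1) by (simp add: sum_distrib_left)
  finally show ?thesis
    by (rule power2_le_imp_le) (use s right_singular_basis(2)[OF A, of 0] mn in simp)
qed

lemma singular_value_1_attained:
  assumes A: "A \<in> carrier_mat m n" and mn: "1 \<le> m" "1 \<le> n"
  obtains v where "v \<in> carrier_vec n" "cnorm v = 1" "cnorm (A *\<^sub>v v) = singular_value 1 A"
proof -
  have s: "singular_value 1 A = singular_value_list A ! 0"
    using A mn by (simp add: singular_value_def)
  obtain U where U: "U \<in> carrier_mat n n" "mat_adjoint U * U = 1\<^sub>m n"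
    and form: "\<And>c. c \<in> carrier_vec n \<Longrightarrow>
      (cnorm (A *\<^sub>v (U *\<^sub>v c)))\<^sup>2 = (\<Sum>i<n. (singular_value_list A ! i * cmod (c $ i))\<^sup>2)"
    using right_singular_basis(1)[OF A] by blast
  define e :: "complex vec" where "e = unit_vec n 0"
  have e: "e \<in> carrier_vec n" by (simp add: e_def)
  have sum_e: "(\<Sum>i<n. (f i * cmod (e $ i))\<^sup>2) = (f 0)\<^sup>2" for f :: "nat \<Rightarrow> real"
  proof -
    have "(\<Sum>i<n. (f i * cmod (e $ i))\<^sup>2) = (\<Sum>i<n. if i = 0 then (f i)\<^sup>2 else 0)"
      using mn by (intro sum.cong refl) (auto simp: e_def)
    then show ?thesis using mn by simp
  qed
  have "(cnorm e)\<^sup>2 = 1"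
    using sum_e[of "\<lambda>_. 1"] e by (simp add: cnorm_power2)
  then have "cnorm e = 1"
    using cnorm_nonneg[of e] by (simp add: power2_eq_1_iff)
  then have "cnorm (U *\<^sub>v e) = 1"
    using cnorm_unitary[OF U e] by simp
  moreover have "(cnorm (A *\<^sub>v (U *\<^sub>v e)))\<^sup>2 = (singular_value 1 A)\<^sup>2"
    unfolding form[OF e] sum_e s ..
  then have "cnorm (A *\<^sub>v (U *\<^sub>v e)) = singular_value 1 A"
    using s right_singular_basis(2)[OF A, of 0] mn by simp
  ultimately show thesis
    using that[of "U *\<^sub>v e"] U(1) e by simp
qed

text \<open>
  The maximizing vector \<open>x\<close> is not assumed to belong to a chosen eigenbasis. When \<open>\<sigma>\<^sub>2 < \<sigma>\<^sub>1\<close>, the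
  equality \<open>|Ax| = \<sigma>\<^sub>1\<close> leaves \<open>x\<close> no component outside the first basis vector, and
  orthogonality to \<open>x\<close> then removes the largest term from the expansion of \<open>|Au|\<^sup>2\<close>.
\<close>

lemma cnorm_mult_le_singular_value_2:
  assumes A: "A \<in> carrier_mat m n" and mn: "2 \<le> m" "2 \<le> n"
    and x: "x \<in> carrier_vec n" "cnorm x = 1" "cnorm (A *\<^sub>v x) = singular_value 1 A"
    and u: "u \<in> carrier_vec n" "u \<bullet>c x = 0"
  shows "cnorm (A *\<^sub>v u) \<le> singular_value 2 A * cnorm u"
proof (cases "singular_value 2 A = singular_value 1 A")
  case True
  then show ?thesis
    using cnorm_mult_le_singular_value_1[OF A _ _ u(1)] mn by simp
next
  case False
  let ?s = "\<lambda>i. singular_value_list A ! i"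
  note nonneg = right_singular_basis(2)[OF A] and mono = right_singular_basis(3)[OF A]
  have s: "singular_value 1 A = ?s 0" "singular_value 2 A = ?s 1"
    using A mn by (simp_all add: singular_value_def)
  have gap: "?s 1 < ?s 0" using False s mono[of 0 1] mn by simp
  obtain U where U: "U \<in> carrier_mat n n" "mat_adjoint U * U = 1\<^sub>m n"
    and form: "\<And>c. c \<in> carrier_vec n \<Longrightarrow>
      (cnorm (A *\<^sub>v (U *\<^sub>v c)))\<^sup>2 = (\<Sum>i<n. (?s i * cmod (c $ i))\<^sup>2)"
    using right_singular_basis(1)[OF A] by blast
  obtain c where c: "c \<in> carrier_vec n" "u = U *\<^sub>v c" "cnorm c = cnorm u"
    using unitary_coordinates[OF U u(1)] .
  obtain d where d: "d \<in> carrier_vec n" "x = U *\<^sub>v d" "cnorm d = cnorm x"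
    using unitary_coordinates[OF U x(1)] .
  \<comment> \<open>A sum of nonnegative terms that measures how far \<open>x\<close> is from attaining the norm.\<close>
  have "(\<Sum>i<n. ((?s 0)\<^sup>2 - (?s i)\<^sup>2) * (cmod (d $ i))\<^sup>2)
      = (?s 0)\<^sup>2 * (cnorm d)\<^sup>2 - (cnorm (A *\<^sub>v x))\<^sup>2"
    unfolding d(2) form[OF d(1)] cnorm_power2[of d]
    using d(1) by (simp add: left_diff_distrib sum_subtractf sum_distrib_left power_mult_distrib)
  also have "\<dots> = 0" using d(3) x s by simp
  finally have "(\<Sum>i<n. ((?s 0)\<^sup>2 - (?s i)\<^sup>2) * (cmod (d $ i))\<^sup>2) = 0" .
  then have terms0: "\<forall>i\<in>{..<n}. ((?s 0)\<^sup>2 - (?s i)\<^sup>2) * (cmod (d $ i))\<^sup>2 = 0"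
    by (subst (asm) sum_nonneg_eq_0_iff) (use nonneg mono in \<open>auto intro!: power_mono\<close>)
  have d0: "d $ i = 0" if "i < n" "i \<noteq> 0" for i
  proof -
    have "?s i \<le> ?s 1" using mono[of 1 i] that by simp
    with gap have "?s i < ?s 0" by simp
    then have "(?s i)\<^sup>2 < (?s 0)\<^sup>2" using nonneg[OF that(1)] by (intro power_strict_mono) auto
    moreover have "((?s 0)\<^sup>2 - (?s i)\<^sup>2) * (cmod (d $ i))\<^sup>2 = 0"
      using terms0 that(1) by blast
    ultimately show ?thesis by simp
  qed
  have split: "(\<Sum>i<n. f i) = f 0 + (\<Sum>i\<in>{1..<n}. f i)" for f :: "nat \<Rightarrow> 'b :: comm_monoid_add"
  proof -
    have "{..<n} = insert 0 {1..<n}" using mn by auto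
    then show ?thesis by simp
  qed
  have "d $ 0 \<noteq> 0"
  proof
    assume "d $ 0 = 0"
    with d0 have "d $ i = 0" if "i < n" for i using that by (cases "i = 0") auto
    then have "(cnorm d)\<^sup>2 = 0" using d(1) by (simp add: cnorm_power2)
    with d(3) x(2) show False by simp
  qed
  moreover have "c \<bullet>c d = c $ 0 * cnj (d $ 0)"
    using c d d0 by (simp add: cscalar_prod_sum split)
  moreover have "c \<bullet>c d = 0"
    using u(2) cscalar_prod_unitary[OF U c(1) d(1)] c(2) d(2) by simp
  ultimately have c0: "c $ 0 = 0" by simp
  have "(cnorm (A *\<^sub>v u))\<^sup>2 \<le> (\<Sum>i<n. (?s 1 * cmod (c $ i))\<^sup>2)"
    unfolding c(2) form[OF c(1)]
  proof (intro sum_mono)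
    fix i assume "i \<in> {..<n}"
    then show "(?s i * cmod (c $ i))\<^sup>2 \<le> (?s 1 * cmod (c $ i))\<^sup>2"
      using c0 nonneg[of i] mono[of 1 i] by (cases "i = 0") (auto intro!: power_mono mult_right_mono)
  qed
  also have "\<dots> = (singular_value 2 A * cnorm u)\<^sup>2"
    unfolding s c(3)[symmetric] power_mult_distrib cnorm_power2
    using c(1) by (simp add: sum_distrib_left)
  finally show ?thesis
    by (rule power2_le_imp_le) (use s nonneg[of 1] mn in simp)
qed


section \<open>Removing the leading singular component\<close>

text \<open>
  The equality case of Cauchy-Schwarz: expanding the square gives \<open>|u - s v|\<^sup>2 = |u|\<^sup>2 - s\<^sup>2 \<le> 0\<close>.
\<close>

lemma eq_smult_of_cscalar_prod_maximal:
  fixes u v :: "complex vec"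
  assumes "u \<in> carrier_vec n" "v \<in> carrier_vec n"
    and "cnorm v = 1" "0 \<le> s" "cnorm u \<le> s" "Re (u \<bullet>c v) = s"
  shows "u = complex_of_real s \<cdot>\<^sub>v v"
proof -
  have dim: "dim_vec u = dim_vec v" using assms(1,2) by simp
  have "(cnorm (u - complex_of_real s \<cdot>\<^sub>v v))\<^sup>2 = (cnorm u)\<^sup>2 - s\<^sup>2"
    unfolding cnorm_diff_smult_power2[OF dim] using assms(3-6) by (simp add: power2_eq_square)
  also have "\<dots> \<le> 0" using power_mono[OF assms(5) cnorm_nonneg, of 2] by simp
  finally have "cnorm (u - complex_of_real s \<cdot>\<^sub>v v) = 0" by simp
  then have "(u - complex_of_real s \<cdot>\<^sub>v v) $ i = 0" if "i < n" for i
    using cnorm_eq_0D that assms(2) by simp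
  then show ?thesis
    using assms(1,2) by (intro eq_vecI) auto
qed

lemma cnorm_diff_projection:
  fixes v x :: "complex vec"
  assumes v: "v \<in> carrier_vec n" and x: "x \<in> carrier_vec n" and x1: "cnorm x = 1"
  shows "cnorm (v - (v \<bullet>c x) \<cdot>\<^sub>v x) \<le> cnorm v" and "(v - (v \<bullet>c x) \<cdot>\<^sub>v x) \<bullet>c x = 0"
proof -
  have dim: "dim_vec v = dim_vec x" using v x by simp
  have Re_self: "Re (cnj k * k) = (cmod k)\<^sup>2" for k
    unfolding cmod_power2 by (simp add: power2_eq_square)
  have "(cnorm (v - (v \<bullet>c x) \<cdot>\<^sub>v x))\<^sup>2 = (cnorm v)\<^sup>2 - (cmod (v \<bullet>c x))\<^sup>2"
    unfolding cnorm_diff_smult_power2[OF dim] Re_self by (simp add: x1)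
  also have "\<dots> \<le> (cnorm v)\<^sup>2" by simp
  finally show "cnorm (v - (v \<bullet>c x) \<cdot>\<^sub>v x) \<le> cnorm v" by (rule power2_le_imp_le) simp
  have "(v - (v \<bullet>c x) \<cdot>\<^sub>v x) \<bullet>c x = v \<bullet>c x - (v \<bullet>c x) * (x \<bullet>c x)"
    using v x by (subst minus_scalar_prod_distrib[of _ n]) simp_all
  then show "(v - (v \<bullet>c x) \<cdot>\<^sub>v x) \<bullet>c x = 0"
    using x1 by (simp add: cscalar_prod_self)
qed

text \<open>
  Put \<open>w = A\<^sup>*y\<close>; then \<open>|w|\<^sup>2 = \<langle>Aw, y\<rangle> \<le> s |w| |y|\<close>, and one factor \<open>|w|\<close> cancels.
\<close>

lemma cnorm_mat_adjoint_mult_le: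
  assumes A: "A \<in> carrier_mat m n" and bound: "\<And>v. v \<in> carrier_vec n \<Longrightarrow> cnorm (A *\<^sub>v v) \<le> s * cnorm v"
    and s: "0 \<le> s" and y: "y \<in> carrier_vec m"
  shows "cnorm (mat_adjoint A *\<^sub>v y) \<le> s * cnorm y"
proof -
  let ?w = "mat_adjoint A *\<^sub>v y"
  have w: "?w \<in> carrier_vec n" by (rule mult_mat_vec_carrier[OF mat_adjoint_carrier[OF A] y])
  have "complex_of_real ((cnorm ?w)\<^sup>2) = (A *\<^sub>v ?w) \<bullet>c y"
    unfolding cscalar_prod_mat_adjoint[OF A w y] by (rule cscalar_prod_self[symmetric])
  then have "(cnorm ?w)\<^sup>2 = cmod ((A *\<^sub>v ?w) \<bullet>c y)"
    by (metis abs_of_nonneg norm_of_real zero_le_power2)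
  also have "\<dots> \<le> cnorm (A *\<^sub>v ?w) * cnorm y"
    using A y by (intro cscalar_prod_le_cnorm) simp
  also have "\<dots> \<le> s * cnorm ?w * cnorm y"
    by (intro mult_right_mono bound w) simp
  finally have "cnorm ?w * cnorm ?w \<le> cnorm ?w * (s * cnorm y)"
    by (simp add: power2_eq_square mult_ac)
  then show ?thesis
  proof (cases "cnorm ?w = 0")
    case False
    then have "0 < cnorm ?w" by (simp add: less_le)
    with \<open>cnorm ?w * cnorm ?w \<le> _\<close> show ?thesis by (rule mult_left_le_imp_le)
  qed (use s in simp)
qed

lemma smult_mat_mult_vec:
  fixes A :: "complex mat"
  assumes "A \<in> carrier_mat m n" "v \<in> carrier_vec n"
  shows "(k \<cdot>\<^sub>m A) *\<^sub>v v = k \<cdot>\<^sub>v (A *\<^sub>v v)"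
  using assms by (intro eq_vecI) (simp_all add: scalar_prod_def sum_distrib_left mult.assoc)

lemma tensor_vec_mult_mat_vec:
  assumes x: "x \<in> carrier_vec n" and y: "y \<in> carrier_vec m" and v: "v \<in> carrier_vec n"
  shows "(y \<otimes>\<^sub>v conjugate x) *\<^sub>v v = (v \<bullet>c x) \<cdot>\<^sub>v y"
proof (rule eq_vecI)
  fix i assume "i < dim_vec ((v \<bullet>c x) \<cdot>\<^sub>v y)"
  then have i: "i < m" using y by simp
  have "((y \<otimes>\<^sub>v conjugate x) *\<^sub>v v) $ i = (\<Sum>j<n. y $ i * cnj (x $ j) * v $ j)"
    using x y v i by (simp add: tensor_vec_def scalar_prod_def atLeast0LessThan)
  also have "\<dots> = ((v \<bullet>c x) \<cdot>\<^sub>v y) $ i"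
    using x y v i by (simp add: cscalar_prod_sum sum_distrib_left mult_ac)
  finally show "((y \<otimes>\<^sub>v conjugate x) *\<^sub>v v) $ i = ((v \<bullet>c x) \<cdot>\<^sub>v y) $ i" .
qed (use y in \<open>simp add: tensor_vec_def\<close>)

text \<open>
  The matrix agrees with \<open>A\<close> on the orthogonal complement of \<open>x\<close> and annihilates \<open>x\<close>. For
  \<open>m, n \<ge> 2\<close> the bound is the one for vectors orthogonal to a maximizer. For a single column,
  the orthogonal complement of \<open>x\<close> is trivial; for a single row, \<open>A\<^sup>*y = \<sigma>\<^sub>1 x\<close> makes the image of
  that complement orthogonal to \<open>y\<close>, which spans the codomain.
\<close>

proposition cnorm_deflation_le_singular_value_2:
  assumes A: "A \<in> carrier_mat m n" and mn: "1 \<le> m" "1 \<le> n"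
    and x: "x \<in> carrier_vec n" "cnorm x = 1" and y: "y \<in> carrier_vec m" "cnorm y = 1"
    and eq: "complex_of_real (singular_value 1 A) = (A *\<^sub>v x) \<bullet>c y"
    and v: "v \<in> carrier_vec n"
  shows "cnorm ((A - complex_of_real (singular_value 1 A) \<cdot>\<^sub>m (y \<otimes>\<^sub>v conjugate x)) *\<^sub>v v)
      \<le> singular_value 2 A * cnorm v"
proof -
  define s where "s = singular_value 1 A"
  note bound = cnorm_mult_le_singular_value_1[OF A mn, folded s_def]
  have s0: "0 \<le> s"
    using order_trans[OF cnorm_nonneg bound[OF x(1)]] x(2) by simp
  have Ax: "A *\<^sub>v x = complex_of_real s \<cdot>\<^sub>v y"
  proof (rule eq_smult_of_cscalar_prod_maximal[OF mult_mat_vec_carrier[OF A x(1)] y s0])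
    show "cnorm (A *\<^sub>v x) \<le> s" using bound[OF x(1)] x(2) by simp
    show "Re ((A *\<^sub>v x) \<bullet>c y) = s" using eq[symmetric] by (simp add: s_def)
  qed
  have Ay: "mat_adjoint A *\<^sub>v y = complex_of_real s \<cdot>\<^sub>v x"
  proof (rule eq_smult_of_cscalar_prod_maximal[OF _ x s0])
    show w: "mat_adjoint A *\<^sub>v y \<in> carrier_vec n"
      by (rule mult_mat_vec_carrier[OF mat_adjoint_carrier[OF A] y(1)])
    show "cnorm (mat_adjoint A *\<^sub>v y) \<le> s"
      using cnorm_mat_adjoint_mult_le[OF A bound s0 y(1)] y(2) by simp
    have "x \<bullet>c (mat_adjoint A *\<^sub>v y) = complex_of_real s"
      using cscalar_prod_mat_adjoint[OF A x(1) y(1)] eq by (simp add: s_def)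
    then have "cnj (x \<bullet>c (mat_adjoint A *\<^sub>v y)) = complex_of_real s" by simp
    moreover have "cnj (x \<bullet>c (mat_adjoint A *\<^sub>v y)) = (mat_adjoint A *\<^sub>v y) \<bullet>c x"
    proof -
      have "dim_vec x = dim_vec (mat_adjoint A *\<^sub>v y)" using w x(1) by (metis carrier_vecD)
      then show ?thesis
        by (simp add: cscalar_prod_sum mult.commute del: index_mult_mat_vec dim_mult_mat_vec)
    qed
    ultimately show "Re ((mat_adjoint A *\<^sub>v y) \<bullet>c x) = s" by (metis Re_complex_of_real)
  qed
  define u where "u = v - (v \<bullet>c x) \<cdot>\<^sub>v x"
  have u: "u \<in> carrier_vec n" using v x by (simp add: u_def)
  have T: "y \<otimes>\<^sub>v conjugate x \<in> carrier_mat m n"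
    using x y by (intro carrier_matI) (simp_all add: tensor_vec_def)
  have "(A - complex_of_real s \<cdot>\<^sub>m (y \<otimes>\<^sub>v conjugate x)) *\<^sub>v v
      = A *\<^sub>v v - complex_of_real s \<cdot>\<^sub>v ((v \<bullet>c x) \<cdot>\<^sub>v y)"
    using minus_mult_distrib_mat_vec[OF A smult_carrier_mat[OF T] v, of "complex_of_real s"]
      smult_mat_mult_vec[OF T v] tensor_vec_mult_mat_vec[OF x(1) y(1) v] by simp
  also have "\<dots> = A *\<^sub>v u"
    unfolding u_def using mult_minus_distrib_mat_vec[OF A v, of "(v \<bullet>c x) \<cdot>\<^sub>v x"] x(1) y(1) Ax
      mult_mat_vec[OF A x(1)] by (simp add: smult_smult_assoc mult.commute)
  finally have Bv: "(A - complex_of_real s \<cdot>\<^sub>m (y \<otimes>\<^sub>v conjugate x)) *\<^sub>v v = A *\<^sub>v u" .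
  have ux: "u \<bullet>c x = 0" and u_le: "cnorm u \<le> cnorm v"
    using cnorm_diff_projection[OF v x] unfolding u_def by blast+
  consider "2 \<le> m" "2 \<le> n" | "n = 1" | "m = 1" using mn by linarith
  then have "cnorm (A *\<^sub>v u) \<le> singular_value 2 A * cnorm v"
  proof cases
    case 1
    have "cnorm (complex_of_real s \<cdot>\<^sub>v y) = s"
    proof (rule power2_eq_imp_eq)
      show "(cnorm (complex_of_real s \<cdot>\<^sub>v y))\<^sup>2 = s\<^sup>2"
        using y(2) cnorm_power2[of y] by (simp add: cnorm_power2 norm_mult power_mult_distrib sum_distrib_left[symmetric])
    qed (simp_all add: s0)
    then have bound2: "cnorm (A *\<^sub>v u) \<le> singular_value 2 A * cnorm u"
      using cnorm_mult_le_singular_value_2[OF A 1 x _ u ux] Ax by (simp add: s_def)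
    have "0 \<le> singular_value 2 A"
      using right_singular_basis(2)[OF A, of 1] 1 A by (simp add: singular_value_def)
    with bound2 u_le show ?thesis by (meson mult_left_mono order_trans)
  next
    case 2
    have "x $ 0 \<noteq> 0" using x 2 by (auto simp: cnorm_def L2_set_def)
    then have "u $ 0 = 0" using ux u x 2 by (simp add: cscalar_prod_sum)
    then have "cnorm u = 0" using u 2 by (simp add: cnorm_def L2_set_def)
    then have "cnorm (A *\<^sub>v u) = 0" using bound[OF u] cnorm_nonneg[of "A *\<^sub>v u"] by simp
    then show ?thesis using 2 A by (simp add: singular_value_def)
  next
    case 3
    have Au: "A *\<^sub>v u \<in> carrier_vec m" by (rule mult_mat_vec_carrier[OF A u])
    have "(A *\<^sub>v u) \<bullet>c y = u \<bullet>c (complex_of_real s \<cdot>\<^sub>v x)"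
      unfolding cscalar_prod_mat_adjoint[OF A u y(1)] Ay ..
    also have "\<dots> = 0" using ux u x by (simp add: conjugate_smult_vec)
    finally have "(A *\<^sub>v u) $ 0 * cnj (y $ 0) = 0"
      using y(1) carrier_matD(1)[OF A] 3 by (subst (asm) cscalar_prod_sum) (simp_all del: index_mult_mat_vec)
    moreover have "y $ 0 \<noteq> 0" using y 3 by (auto simp: cnorm_def L2_set_def)
    ultimately have "(A *\<^sub>v u) $ 0 = 0" by simp
    then have "cnorm (A *\<^sub>v u) = 0"
      using carrier_vecD[OF Au] 3 by (simp add: cnorm_def L2_set_def del: index_mult_mat_vec dim_mult_mat_vec)
    then show ?thesis using 3 A by (simp add: singular_value_def)
  qed
  then show ?thesis using Bv by (simp add: s_def)
qed

section \<open>The box norm and the operator norm\<close>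

lemma bij_betw_pick:
  assumes "finite X"
  shows "bij_betw (pick X) {..<card X} X"
proof -
  have inj: "inj_on (pick X) {..<card X}"
    by (rule linorder_inj_onI) (auto dest: pick_mono_le[rotated])
  moreover have "pick X ` {..<card X} = X"
    using assms pick_in_set_le card_image[OF inj] by (intro card_subset_eq) auto
  ultimately show ?thesis by (simp add: bij_betw_def)
qed

lemma sum_mat_submatrix:
  assumes X: "X \<subseteq> {..<dim_row A}" and Y: "Y \<subseteq> {..<dim_col A}"
  shows "sum_mat (submatrix A X Y) = (\<Sum>i\<in>X. \<Sum>j\<in>Y. A $$ (i, j))"
proof -
  have eqs: "{i. i < dim_row A \<and> i \<in> X} = X" "{j. j < dim_col A \<and> j \<in> Y} = Y"
    using X Y by auto
  have fin: "finite X" "finite Y" using X Y finite_subset by blast+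
  have "sum_mat (submatrix A X Y) = (\<Sum>i<card X. \<Sum>j<card Y. A $$ (pick X i, pick Y j))"
  proof -
    have "sum_mat (submatrix A X Y) = (\<Sum>(i, j)\<in>{..<card X} \<times> {..<card Y}. A $$ (pick X i, pick Y j))"
      unfolding sum_mat_def by (intro sum.cong) (auto simp: submatrix_def eqs)
    then show ?thesis by (simp add: sum.cartesian_product)
  qed
  also have "\<dots> = (\<Sum>i\<in>X. \<Sum>j<card Y. A $$ (i, pick Y j))"
    by (rule sum.reindex_bij_betw[OF bij_betw_pick[OF fin(1)]])
  also have "\<dots> = (\<Sum>i\<in>X. \<Sum>j\<in>Y. A $$ (i, j))"
    by (intro sum.cong refl sum.reindex_bij_betw[OF bij_betw_pick[OF fin(2)]])
  finally show ?thesis .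
qed

text \<open>The entry sum of a submatrix is the sesquilinear form of \<open>B\<close> at two indicator vectors.\<close>

lemma box_norm_le:
  assumes B: "B \<in> carrier_mat m n" and mn: "1 \<le> m" "1 \<le> n"
    and bound: "\<And>v. v \<in> carrier_vec n \<Longrightarrow> cnorm (B *\<^sub>v v) \<le> s * cnorm v"
  shows "box_norm B \<le> s"
proof -
  let ?q = "\<lambda>X Y. 1 / sqrt (real (card X) * real (card Y)) * cmod (sum_mat (submatrix B X Y))"
  let ?S = "{?q X Y | X Y. X \<noteq> {} \<and> X \<subseteq> {..<dim_row B} \<and> Y \<noteq> {} \<and> Y \<subseteq> {..<dim_col B}}"
  have "?S \<subseteq> (\<lambda>(X, Y). ?q X Y) ` (Pow {..<dim_row B} \<times> Pow {..<dim_col B})" by auto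
  then have fin: "finite ?S" by (rule finite_subset) simp
  have "?q {0} {0} \<in> ?S"
    by (rule CollectI, rule exI[of _ "{0}"], rule exI[of _ "{0}"])
      (use mn in \<open>simp add: carrier_matD[OF B] less_eq_Suc_le\<close>)
  then have ne: "?S \<noteq> {}" by blast
  have "?q X Y \<le> s" if X: "X \<noteq> {}" "X \<subseteq> {..<m}" and Y: "Y \<noteq> {}" "Y \<subseteq> {..<n}" for X Y
  proof -
    define ind where "ind = (\<lambda>k Z. vec k (\<lambda>i. if i \<in> Z then 1 else 0 :: complex))"
    have ind: "ind k Z \<in> carrier_vec k" for k Z by (simp add: ind_def)
    have cnorm_ind: "cnorm (ind k Z) = sqrt (card Z)" if "Z \<subseteq> {..<k}" for k Z
    proof -
      have "(\<Sum>i<k. (cmod (ind k Z $ i))\<^sup>2) = (\<Sum>i<k. if i \<in> Z then 1 else 0)"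
        by (intro sum.cong refl) (simp add: ind_def)
      also have "\<dots> = card Z" using that by (simp add: sum.If_cases Int_absorb1)
      finally show ?thesis by (simp add: cnorm_def L2_set_def ind_def)
    qed
    have sum_ind: "(\<Sum>i<k. f i * (if i \<in> Z then 1 else 0)) = (\<Sum>i\<in>Z. f i)"
      if "Z \<subseteq> {..<k}" for f :: "nat \<Rightarrow> complex" and k Z
    proof -
      have "(\<Sum>i<k. f i * (if i \<in> Z then 1 else 0)) = (\<Sum>i<k. if i \<in> Z then f i else 0)"
        by (intro sum.cong refl) simp
      then show ?thesis using that by (simp add: sum.If_cases Int_absorb1)
    qed
    have Bv: "(B *\<^sub>v ind n Y) $ i = (\<Sum>j\<in>Y. B $$ (i, j))" if "i < m" for i
      using sum_ind[OF Y(2), of "\<lambda>j. B $$ (i, j)"] B that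
      by (simp add: ind_def scalar_prod_def atLeast0LessThan)
    have "(B *\<^sub>v ind n Y) \<bullet>c ind m X = (\<Sum>i<m. (\<Sum>j\<in>Y. B $$ (i, j)) * (if i \<in> X then 1 else 0))"
      using B by (subst cscalar_prod_sum) (auto simp: ind_def Bv[unfolded ind_def] simp del: index_mult_mat_vec intro!: sum.cong)
    then have "sum_mat (submatrix B X Y) = (B *\<^sub>v ind n Y) \<bullet>c ind m X"
      using sum_mat_submatrix[of X B Y] X Y B sum_ind[OF X(2)] by simp
    also have "cmod \<dots> \<le> cnorm (B *\<^sub>v ind n Y) * cnorm (ind m X)"
      using B by (intro cscalar_prod_le_cnorm) (simp add: ind_def)
    also have "\<dots> \<le> s * cnorm (ind n Y) * cnorm (ind m X)"
      by (intro mult_right_mono bound ind) simp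
    also have "\<dots> = s * sqrt (real (card X) * real (card Y))"
      by (simp add: cnorm_ind X Y real_sqrt_mult)
    finally have le: "cmod (sum_mat (submatrix B X Y)) \<le> s * sqrt (real (card X) * real (card Y))" .
    have "finite X" "finite Y" using X Y finite_subset by blast+
    then have "0 < sqrt (real (card X) * real (card Y))" using X Y by (simp add: card_gt_0_iff)
    with le show ?thesis by (simp add: field_simps)
  qed
  then show ?thesis
    unfolding box_norm_def using B by (subst Max_le_iff[OF fin ne]) auto
qed

section \<open>Nonnegative matrices with constant row and column sums\<close>

text \<open>
  Splitting \<open>|a\<^sub>i\<^sub>j|\<close> as a product of two square roots and applying Cauchy-Schwarz to each row gives
  \<open>|(Av)\<^sub>i|\<^sup>2 \<le> r \<Sum>\<^sub>j |a\<^sub>i\<^sub>j| |v\<^sub>j|\<^sup>2\<close>; summing over \<open>i\<close> brings in the column sums.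
\<close>

lemma schur_test:
  assumes A: "A \<in> carrier_mat m n" and v: "v \<in> carrier_vec n" and r: "0 \<le> r"
    and rows: "\<And>i. i < m \<Longrightarrow> (\<Sum>j<n. cmod (A $$ (i, j))) \<le> r"
    and cols: "\<And>j. j < n \<Longrightarrow> (\<Sum>i<m. cmod (A $$ (i, j))) \<le> c"
  shows "(cnorm (A *\<^sub>v v))\<^sup>2 \<le> r * c * (cnorm v)\<^sup>2"
proof -
  let ?a = "\<lambda>i j. cmod (A $$ (i, j))"
  have row_le: "(cmod ((A *\<^sub>v v) $ i))\<^sup>2 \<le> r * (\<Sum>j<n. ?a i j * (cmod (v $ j))\<^sup>2)" if i: "i < m" for i
  proof -
    let ?f = "\<lambda>j. sqrt (?a i j)" and ?g = "\<lambda>j. sqrt (?a i j) * cmod (v $ j)"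
    have "cmod ((A *\<^sub>v v) $ i) \<le> (\<Sum>j<n. ?a i j * cmod (v $ j))"
      using A v i by (simp add: scalar_prod_def atLeast0LessThan sum_norm_le norm_mult)
    also have "\<dots> = (\<Sum>j<n. \<bar>?f j\<bar> * \<bar>?g j\<bar>)"
      by (intro sum.cong refl) (simp add: abs_mult mult.assoc[symmetric])
    also have "\<dots> \<le> L2_set ?f {..<n} * L2_set ?g {..<n}"
      by (rule L2_set_mult_ineq)
    finally have "(cmod ((A *\<^sub>v v) $ i))\<^sup>2 \<le> (L2_set ?f {..<n} * L2_set ?g {..<n})\<^sup>2"
      by (rule power_mono) simp
    also have "\<dots> = (\<Sum>j<n. ?a i j) * (\<Sum>j<n. ?a i j * (cmod (v $ j))\<^sup>2)"
      by (simp add: L2_set_def power_mult_distrib sum_nonneg)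
    also have "\<dots> \<le> r * (\<Sum>j<n. ?a i j * (cmod (v $ j))\<^sup>2)"
      by (intro mult_right_mono rows i sum_nonneg) simp
    finally show ?thesis .
  qed
  have "(cnorm (A *\<^sub>v v))\<^sup>2 = (\<Sum>i<m. (cmod ((A *\<^sub>v v) $ i))\<^sup>2)"
    using A by (simp add: cnorm_power2)
  also have "\<dots> \<le> (\<Sum>i<m. r * (\<Sum>j<n. ?a i j * (cmod (v $ j))\<^sup>2))"
    by (intro sum_mono row_le) simp
  also have "\<dots> = r * (\<Sum>i<m. \<Sum>j<n. ?a i j * (cmod (v $ j))\<^sup>2)"
    by (simp add: sum_distrib_left)
  also have "(\<Sum>i<m. \<Sum>j<n. ?a i j * (cmod (v $ j))\<^sup>2) = (\<Sum>j<n. (\<Sum>i<m. ?a i j) * (cmod (v $ j))\<^sup>2)"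
    by (subst sum.swap) (simp add: sum_distrib_right)
  also have "r * \<dots> \<le> r * (\<Sum>j<n. c * (cmod (v $ j))\<^sup>2)"
    by (intro mult_left_mono sum_mono mult_right_mono cols r) simp_all
  also have "\<dots> = r * c * (cnorm v)\<^sup>2"
    using v by (simp add: cnorm_power2 sum_distrib_left mult.assoc)
  finally show ?thesis .
qed

text \<open>
  With row sums \<open>r\<close>, column sums \<open>c\<close> and total \<open>S = m r = n c\<close>, the value \<open>s = S / sqrt (m n)\<close> of the
  form \<open>\<langle>Ax, y\<rangle>\<close> satisfies \<open>s\<^sup>2 = r c\<close>, which is exactly the bound of the Schur test.
\<close>

lemma singular_value_1_constant_sums:
  assumes A: "A \<in> carrier_mat m n" and mn: "1 \<le> m" "1 \<le> n"
    and nonneg: "nonneg_entries A" and row: "equal_row_sums A" and col: "equal_col_sums A"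
  defines "x \<equiv> vec n (\<lambda>_. complex_of_real (1 / sqrt n))"
    and "y \<equiv> vec m (\<lambda>_. complex_of_real (1 / sqrt m))"
  shows "complex_of_real (singular_value 1 A) = (A *\<^sub>v x) \<bullet>c y"
    and "complex_of_real (singular_value 1 A) \<cdot>\<^sub>m (y \<otimes>\<^sub>v conjugate x) = density_mat A \<cdot>\<^sub>m all_ones_mat m n"
    and "cnorm x = 1" and "cnorm y = 1"
proof -
  define a where "a = (\<lambda>i j. cmod (A $$ (i, j)))"
  have Aa: "A $$ (i, j) = complex_of_real (a i j)" if "i < m" "j < n" for i j
    using nonneg A that unfolding a_def nonneg_entries_def
    by (metis carrier_matD nonneg_Reals_cases norm_of_real abs_of_nonneg)
  define r where "r = (\<Sum>j<n. a 0 j)"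
  define c where "c = (\<Sum>i<m. a i 0)"
  define S where "S = (\<Sum>i<m. \<Sum>j<n. a i j)"
  have a0: "0 \<le> a i j" for i j by (simp add: a_def)
  have rows: "(\<Sum>j<n. a i j) = r" if "i < m" for i
  proof -
    have "(\<Sum>j<n. A $$ (i, j)) = (\<Sum>j<n. A $$ (0, j))"
      using row[unfolded equal_row_sums_def carrier_matD[OF A], rule_format, OF that, of 0] mn by linarith
    then have "complex_of_real (\<Sum>j<n. a i j) = complex_of_real r"
      using that mn by (simp add: r_def Aa)
    then show ?thesis by (rule of_real_eq_iff[THEN iffD1])
  qed
  have cols: "(\<Sum>i<m. a i j) = c" if "j < n" for j
  proof -
    have "(\<Sum>i<m. A $$ (i, j)) = (\<Sum>i<m. A $$ (i, 0))"
      using col[unfolded equal_col_sums_def carrier_matD[OF A], rule_format, OF that, of 0] mn by linarith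
    then have "complex_of_real (\<Sum>i<m. a i j) = complex_of_real c"
      using that mn by (simp add: c_def Aa)
    then show ?thesis by (rule of_real_eq_iff[THEN iffD1])
  qed
  have Sr: "S = m * r" by (simp add: S_def rows)
  have Sc: "S = n * c" unfolding S_def by (subst sum.swap) (simp add: cols)
  have rc: "0 \<le> r" "0 \<le> c" "0 \<le> S" by (simp_all add: r_def c_def S_def a0 sum_nonneg)
  have pos: "0 < real m" "0 < real n" using mn by auto
  define s where "s = S / (sqrt m * sqrt n)"
  have s0: "0 \<le> s" using rc by (simp add: s_def)
  have s2: "s\<^sup>2 = r * c"
  proof -
    have "s\<^sup>2 = (m * r) * (n * c) / (real m * real n)"
      unfolding s_def power_divide power_mult_distrib power2_eq_square[of S]
      by (simp flip: Sr Sc)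
    then show ?thesis using pos by simp
  qed
  show x1: "cnorm x = 1" and y1: "cnorm y = 1"
    using pos by (simp_all add: cnorm_def L2_set_def x_def y_def norm_divide power_divide)
  have xc: "x \<in> carrier_vec n" and yc: "y \<in> carrier_vec m" by (simp_all add: x_def y_def)
  have Ax: "(A *\<^sub>v x) $ i = complex_of_real (r / sqrt n)" if "i < m" for i
    using A that by (simp add: x_def scalar_prod_def atLeast0LessThan Aa sum_divide_distrib[symmetric] flip: rows[OF that])
  have "(A *\<^sub>v x) \<bullet>c y = (\<Sum>i<m. complex_of_real (r / sqrt n) * cnj (y $ i))"
    using A yc by (subst cscalar_prod_sum) (auto simp: Ax simp del: index_mult_mat_vec)
  also have "\<dots> = complex_of_real (m * (r / sqrt n * (1 / sqrt m)))"
    by (simp add: y_def)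
  also have "m * (r / sqrt n * (1 / sqrt m)) = s"
    by (simp add: s_def Sr)
  finally have Axy: "(A *\<^sub>v x) \<bullet>c y = complex_of_real s" .
  have "s \<le> singular_value 1 A"
  proof -
    have "s = cmod ((A *\<^sub>v x) \<bullet>c y)" using s0 by (simp add: Axy)
    also have "\<dots> \<le> cnorm (A *\<^sub>v x) * cnorm y"
      using A yc by (intro cscalar_prod_le_cnorm) simp
    also have "\<dots> \<le> singular_value 1 A"
      using cnorm_mult_le_singular_value_1[OF A mn xc] by (simp add: x1 y1)
    finally show ?thesis .
  qed
  moreover have "singular_value 1 A \<le> s"
  proof -
    obtain v where v: "v \<in> carrier_vec n" "cnorm v = 1" "cnorm (A *\<^sub>v v) = singular_value 1 A"
      using singular_value_1_attained[OF A mn] .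
    have "(cnorm (A *\<^sub>v v))\<^sup>2 \<le> s\<^sup>2"
      using schur_test[OF A v(1) rc(1), of c] rows cols v(2) by (simp add: a_def s2)
    then show ?thesis
      using power2_le_imp_le[OF _ s0] v(3) by simp
  qed
  ultimately have s_eq: "singular_value 1 A = s" by simp
  then show "complex_of_real (singular_value 1 A) = (A *\<^sub>v x) \<bullet>c y" using Axy by simp
  have "sum_mat A = complex_of_real S"
  proof -
    have "sum_mat A = (\<Sum>(i, j)\<in>{..<m} \<times> {..<n}. complex_of_real (a i j))"
      unfolding sum_mat_def using carrier_matD[OF A] by (intro sum.cong) (auto simp: Aa)
    then show ?thesis by (simp only: S_def of_real_sum sum.cartesian_product split_def)
  qed
  then have dens: "density_mat A = complex_of_real (S / (m * n))"
    using A by (simp add: density_mat_def)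
  have "s * (1 / sqrt m * (1 / sqrt n)) = S / (m * n)"
    by (simp add: s_def real_sqrt_mult[symmetric])
  then have "complex_of_real s * (complex_of_real (1 / sqrt m) * complex_of_real (1 / sqrt n)) = complex_of_real (S / (m * n))"
    by (metis of_real_mult)
  then show "complex_of_real (singular_value 1 A) \<cdot>\<^sub>m (y \<otimes>\<^sub>v conjugate x) = density_mat A \<cdot>\<^sub>m all_ones_mat m n"
    unfolding s_eq dens by (intro eq_matI) (simp_all add: tensor_vec_def all_ones_mat_def x_def y_def mult.commute)
qed

theorem theorem4:
  fixes A :: "complex mat" and m n :: nat
  assumes "m \<ge> 1" and "n \<ge> 1" and "A \<in> carrier_mat m n"
  shows "(\<forall>x \<in> carrier_vec n. \<forall>y \<in> carrier_vec m.
            x \<bullet>c x = 1 \<longrightarrow> y \<bullet>c y = 1 \<longrightarrow>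
            complex_of_real (singular_value 1 A) = (A *\<^sub>v x) \<bullet>c y \<longrightarrow>
            singular_value 2 A
              \<ge> box_norm (A - complex_of_real (singular_value 1 A) \<cdot>\<^sub>m (y \<otimes>\<^sub>v conjugate x)))
       \<and> (nonneg_entries A \<and> equal_row_sums A \<and> equal_col_sums A \<longrightarrow>
            singular_value 2 A \<ge> box_norm (A - density_mat A \<cdot>\<^sub>m all_ones_mat m n))"
proof -
  note mn = assms(1,2) and A = assms(3)
  have main: "box_norm (A - complex_of_real (singular_value 1 A) \<cdot>\<^sub>m (y \<otimes>\<^sub>v conjugate x)) \<le> singular_value 2 A"
    if x: "x \<in> carrier_vec n" "cnorm x = 1" and y: "y \<in> carrier_vec m" "cnorm y = 1"
      and eq: "complex_of_real (singular_value 1 A) = (A *\<^sub>v x) \<bullet>c y" for x y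
  proof (rule box_norm_le[OF _ mn])
    show "A - complex_of_real (singular_value 1 A) \<cdot>\<^sub>m (y \<otimes>\<^sub>v conjugate x) \<in> carrier_mat m n"
      using x y by (intro carrier_matI) (simp_all add: tensor_vec_def)
  qed (rule cnorm_deflation_le_singular_value_2[OF A mn x y eq])
  show ?thesis
  proof (intro conjI ballI impI)
    fix x y
    assume "x \<in> carrier_vec n" "y \<in> carrier_vec m" "x \<bullet>c x = 1" "y \<bullet>c y = 1"
      "complex_of_real (singular_value 1 A) = (A *\<^sub>v x) \<bullet>c y"
    then show "box_norm (A - complex_of_real (singular_value 1 A) \<cdot>\<^sub>m (y \<otimes>\<^sub>v conjugate x)) \<le> singular_value 2 A"
      by (intro main) (simp_all only: cnorm_eq_1_iff)
  next
    assume "nonneg_entries A \<and> equal_row_sums A \<and> equal_col_sums A"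
    then have "nonneg_entries A" "equal_row_sums A" "equal_col_sums A" by auto
    note top = singular_value_1_constant_sums[OF A mn this]
    show "box_norm (A - density_mat A \<cdot>\<^sub>m all_ones_mat m n) \<le> singular_value 2 A"
      unfolding top(2)[symmetric] by (rule main[OF _ top(3) _ top(4) top(1)]) simp_all
  qed
qed

end
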